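(* Let $\mathbf{P}=(P_1,\ldots,P_n)^\top:\mathbb{R}^n\to\mathbb{R}^n$ be a polynomial map, where each $P_i$ is a polynomial of degree $d_i\ge 1$ with nonnegative coefficients. Let $\delta_1,\ldots,\delta_n\in(0,\infty)$ be given and assume that $\delta_i\ge d_i$ for $i\in[n]$. Consider the system $$P_i(\mathbf{x})=\lambda x_i^{\delta_i},\quad i\in[n],\qquad \mathbf{x}\ge\mathbf{0}.\qquad (\mathrm{S})$$ (1) Assume that $\mathbf{P}$ is weakly irreducible. Then for each $a,p>0$ there exists a unique positive vector $\mathbf{x}>\mathbf{0}$, depending on $a,p$, satisfying (S) and the condition $\|\mathbf{x}\|_p=a$. (2) Suppose furthermore that $\mathbf{P}$ is irreducible. Then the system (S) has a unique solution, depending on $a,p$, satisfying $\|\mathbf{x}\|_p=a$, and all the coordinates of this solution are positive.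
   Context: $[n]=\{1,\ldots,n\}$, $\mathbb{R}_+=[0,\infty)$, $\|\mathbf{x}\|_p=(\sum_i|x_i|^p)^{1/p}$ for $p>0$. $\mathbf{x}\ge\mathbf 0$ (resp. $\mathbf{x}>\mathbf 0$) means that all coordinates are nonnegative (resp. positive). A vector $\mathbf{x}$ satisfies (S) if (S) holds for some scalar $\lambda$. The di-graph $G(\mathbf{P})$ has vertex set $[n]$, and $(i,j)$ is a di-edge if the variable $x_j$ effectively appears in the expression of $P_i$ (i.e. in a monomial of $P_i$ with nonzero coefficient), or if this expression contains a monomial (with nonzero coefficient) of degree $<d_i$. $\mathbf{P}$ is weakly irreducible if $G(\mathbf{P})$ is strongly connected. For $I\subset[n]$, the part $Q_I$ is the set of $\mathbf{x}=(x_1,\ldots,x_n)^\top\in\mathbb{R}_+^n$ such that $x_i>0$ if and only if $i\in I$. $\mathbf{P}$ is irreducible if there is no part of $\mathbb{R}_+^n$ that is invariant by $\mathbf{P}$ (i.e. $\mathbf{P}(Q_I)\subset Q_I$), except the trivial parts $Q_\emptyset$ and $Q_{[n]}$.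
   Formalization: Part (2) is false as stated: P=(x_2^2, x_1x_2), δ=(2,2) has the extra solution (a,0) with λ=0. It is proved instead for solutions with λ≠0, and for arbitrary λ under the added (necessary) assumption that P(x)≠0 for every nonzero x≥0. *)

theory Defs
  imports "HOL-Analysis.Analysis" "HOL-Library.Poly_Mapping"
begin

text \<open>
  A real polynomial in the variables indexed by \<^typ>\<open>'n\<close> is a finitely supported family of
  coefficients, indexed by exponent vectors.
\<close>

type_synonym 'n rpoly = "('n \<Rightarrow>\<^sub>0 nat) \<Rightarrow>\<^sub>0 real"

definition monom_degree :: "('n::finite \<Rightarrow>\<^sub>0 nat) \<Rightarrow> nat" where
  "monom_degree m = (\<Sum>i\<in>UNIV. Poly_Mapping.lookup m i)"

text \<open>The total degree; by convention it is 0 for the zero polynomial.\<close>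

definition poly_degree :: "'n::finite rpoly \<Rightarrow> nat" where
  "poly_degree q = Max (insert 0 (monom_degree ` Poly_Mapping.keys q))"

definition poly_eval :: "'n::finite rpoly \<Rightarrow> real ^ 'n \<Rightarrow> real" where
  "poly_eval q x =
     (\<Sum>m\<in>Poly_Mapping.keys q. Poly_Mapping.lookup q m *
        (\<Prod>i\<in>UNIV. (x $ i) ^ Poly_Mapping.lookup m i))"

definition poly_map :: "('n::finite \<Rightarrow> 'n rpoly) \<Rightarrow> real ^ 'n \<Rightarrow> real ^ 'n" where
  "poly_map P x = (\<chi> i. poly_eval (P i) x)"

definition appears_in :: "'n \<Rightarrow> 'n rpoly \<Rightarrow> bool" where
  "appears_in j q \<longleftrightarrow> (\<exists>m\<in>Poly_Mapping.keys q. 0 < Poly_Mapping.lookup m j)"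

definition digraph_edges :: "('n::finite \<Rightarrow> 'n rpoly) \<Rightarrow> ('n \<times> 'n) set" where
  "digraph_edges P = {(i, j). appears_in j (P i) \<or>
                              (\<exists>m\<in>Poly_Mapping.keys (P i). monom_degree m < poly_degree (P i))}"

definition weakly_irreducible :: "('n::finite \<Rightarrow> 'n rpoly) \<Rightarrow> bool" where
  "weakly_irreducible P \<longleftrightarrow> (\<forall>i j. (i, j) \<in> (digraph_edges P)\<^sup>*)"

definition orthant_part :: "'n::finite set \<Rightarrow> (real ^ 'n) set" where
  "orthant_part I = {x. (\<forall>i. 0 \<le> x $ i) \<and> (\<forall>i. 0 < x $ i \<longleftrightarrow> i \<in> I)}"

text \<open>
  Invariance refers to the part itself and not to its closure. In particular, a nontrivial part
  that is mapped into \<^term>\<open>orthant_part {}\<close> (the origin) is not invariant, so irreducibility does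
  not exclude that the map vanishes at some nonzero nonnegative vector.
\<close>

definition irreducible_map :: "('n::finite \<Rightarrow> 'n rpoly) \<Rightarrow> bool" where
  "irreducible_map P \<longleftrightarrow>
     (\<forall>I. poly_map P ` orthant_part I \<subseteq> orthant_part I \<longrightarrow> I = {} \<or> I = UNIV)"

definition lp_norm :: "real \<Rightarrow> real ^ 'n::finite \<Rightarrow> real" where
  "lp_norm p x = (\<Sum>i\<in>UNIV. \<bar>x $ i\<bar> powr p) powr (1 / p)"

text \<open>
  The system with the scalar \<open>l\<close>. On nonnegative \<open>x\<close> and for positive exponents, \<open>powr\<close> is the
  usual real power, including \<open>0 powr r = 0\<close>.
\<close>

definition solves_with ::
    "('n::finite \<Rightarrow> 'n rpoly) \<Rightarrow> ('n \<Rightarrow> real) \<Rightarrow> real \<Rightarrow> real ^ 'n \<Rightarrow> bool" where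
  "solves_with P \<delta> l x \<longleftrightarrow>
     (\<forall>i. poly_map P x $ i = l * (x $ i) powr \<delta> i) \<and> (\<forall>i. 0 \<le> x $ i)"

definition solves :: "('n::finite \<Rightarrow> 'n rpoly) \<Rightarrow> ('n \<Rightarrow> real) \<Rightarrow> real ^ 'n \<Rightarrow> bool" where
  "solves P \<delta> x \<longleftrightarrow> (\<exists>l. solves_with P \<delta> l x)"

definition solves_nonzero :: "('n::finite \<Rightarrow> 'n rpoly) \<Rightarrow> ('n \<Rightarrow> real) \<Rightarrow> real ^ 'n \<Rightarrow> bool" where
  "solves_nonzero P \<delta> x \<longleftrightarrow> (\<exists>l. l \<noteq> 0 \<and> solves_with P \<delta> l x)"

end

theory Submission
  imports Defs
begin

text \<open>
  On the sphere of radius \<open>a\<close> the polynomial \<open>P i\<close> coincides with a function \<open>F i\<close> that is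
  homogeneous of degree \<open>\<delta> i\<close>, monotone, and strictly monotone in \<open>x $ j\<close> for every edge \<open>(i, j)\<close>,
  so positive solutions are nonlinear Perron vectors of \<open>F\<close>. Uniqueness: if \<open>t\<close> is the largest
  quotient \<open>x $ i / y $ i\<close> of two solutions, strict monotonicity along an edge leaving the set of
  maximising indices shows that this set is everything. Existence: the maximum over \<open>i\<close> of
  \<open>F i x / (x $ i) powr \<delta> i\<close> attains its minimum, because strong connectivity bounds the
  quotients of the coordinates on sublevel sets, and at a suitable minimiser all these ratios agree.
  For irreducible \<open>P\<close>, the part containing a solution with \<open>\<lambda> \<noteq> 0\<close> is invariant, hence is the
  interior of the orthant.
\<close>

section \<open>Nonlinear Perron vectors\<close>

text \<open>Strictness can fail on the boundary of the orthant, where monomials vanish, so the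
  axioms concern positive vectors. \<open>coercive\<close> looks only at coordinates at least 1: the
  ratios studied below are scale invariant, so the smallest coordinate can be normalised to
  1.\<close>

locale homogeneous_system =
  fixes F :: "'n::finite \<Rightarrow> real ^ 'n \<Rightarrow> real"
    and \<delta> :: "'n \<Rightarrow> real"
    and E :: "('n \<times> 'n) set"
  assumes delta_pos: "0 < \<delta> i"
    and nonneg: "(\<And>k. 0 < x $ k) \<Longrightarrow> 0 \<le> F i x"
    and homogeneous: "0 < t \<Longrightarrow> (\<And>k. 0 < x $ k) \<Longrightarrow> F i (t *\<^sub>R x) = t powr \<delta> i * F i x"
    and mono: "(\<And>k. 0 < x $ k) \<Longrightarrow> x \<le> y \<Longrightarrow> F i x \<le> F i y"
    and strict: "(i, j) \<in> E \<Longrightarrow> (\<And>k. 0 < x $ k) \<Longrightarrow> x \<le> y \<Longrightarrow> x $ j < y $ j \<Longrightarrow> F i x < F i y"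
    and continuous: "continuous_on {x. \<forall>k. 0 < x $ k} (F i)"
    and coercive: "(i, j) \<in> E \<Longrightarrow> \<exists>C. \<forall>x. (\<forall>k. 1 \<le> x $ k) \<longrightarrow> F i x \<le> B \<longrightarrow> x $ j \<le> C"
    and connected: "(i, j) \<in> E\<^sup>*"
begin

text \<open>A set without outgoing edges is closed under \<open>E\<^sup>*\<close>, which relates all
  pairs.\<close>

lemma edge_leaving:
  assumes "i \<in> S" "j \<notin> S"
  obtains k l where "k \<in> S" "l \<notin> S" "(k, l) \<in> E"
proof -
  have "\<not> E `` S \<subseteq> S"
    using Image_closed_trancl[of E S] connected[of i j] assms by blast
  then show thesis
    using that by blast
qed

section \<open>Comparison of eigenpairs and uniqueness up to scaling\<close>

definition eigenpair :: "real \<Rightarrow> real ^ 'n \<Rightarrow> bool" where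
  "eigenpair l x \<longleftrightarrow> (\<forall>i. 0 < x $ i) \<and> (\<forall>i. F i x = l * (x $ i) powr \<delta> i)"

text \<open>The largest quotient \<open>x $ i / y $ i\<close> is the least \<open>t\<close> for
  which \<open>t *\<^sub>R y\<close> dominates \<open>x\<close>; the two vectors touch where it is
  attained.\<close>

lemma touching_multiple:
  fixes x y :: "real ^ 'n"
  assumes "\<And>i. 0 < x $ i" "\<And>i. 0 < y $ i"
  obtains t i where "0 < t" "x \<le> t *\<^sub>R y" "x $ i = t * y $ i"
proof -
  define t where "t = Max (range (\<lambda>i. x $ i / y $ i))"
  have "t \<in> range (\<lambda>i. x $ i / y $ i)"
    unfolding t_def by (intro Max_in) auto
  then obtain i where i: "t = x $ i / y $ i" by blast
  have "x $ k / y $ k \<le> t" for k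
    unfolding t_def by (intro Max_ge) auto
  then have "x \<le> t *\<^sub>R y"
    using assms by (auto simp: less_eq_vec_def pos_divide_le_eq)
  moreover have "0 < t" "x $ i = t * y $ i"
    using assms[of i] i by auto
  ultimately show thesis using that by blast
qed

text \<open>At a touching coordinate, monotonicity and homogeneity compare \<open>l\<close> and
  \<open>m\<close> times the same positive power. By symmetry, all eigenpairs share one
  eigenvalue.\<close>

lemma eigenvalue_le:
  assumes "eigenpair l x" "eigenpair m y"
  shows "l \<le> m"
proof -
  have pos: "\<And>i. 0 < x $ i" "\<And>i. 0 < y $ i"
    and eq: "\<And>i. F i x = l * (x $ i) powr \<delta> i" "\<And>i. F i y = m * (y $ i) powr \<delta> i"
    using assms by (auto simp: eigenpair_def)
  obtain t i where t: "0 < t" "x \<le> t *\<^sub>R y" "x $ i = t * y $ i"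
    using touching_multiple[OF pos] by blast
  have "l * (x $ i) powr \<delta> i \<le> F i (t *\<^sub>R y)"
    using mono[OF pos(1) t(2), of i] eq by simp
  also have "\<dots> = m * (x $ i) powr \<delta> i"
    using homogeneous[OF t(1) pos(2)] t eq pos(2)[of i] by (simp add: powr_mult)
  finally show ?thesis
    using pos(1)[of i] by simp
qed

lemma eigenvector_unique:
  assumes "eigenpair l x" "eigenpair m y"
  shows "\<exists>t>0. x = t *\<^sub>R y"
proof -
  have "l = m"
    using eigenvalue_le assms by (meson order_antisym)
  have pos: "\<And>i. 0 < x $ i" "\<And>i. 0 < y $ i"
    and eq: "\<And>i. F i x = l * (x $ i) powr \<delta> i" "\<And>i. F i y = l * (y $ i) powr \<delta> i"
    using assms \<open>l = m\<close> by (auto simp: eigenpair_def)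
  obtain t i where t: "0 < t" "x \<le> t *\<^sub>R y" "x $ i = t * y $ i"
    using touching_multiple[OF pos] by blast
  have "x $ j = t * y $ j" for j
  proof (rule ccontr)
    assume "x $ j \<noteq> t * y $ j"
    then obtain k k' where k: "x $ k = t * y $ k" "x $ k' \<noteq> t * y $ k'" "(k, k') \<in> E"
      using edge_leaving[of i "{i. x $ i = t * y $ i}" j] t by auto
    \<comment> \<open>The edge runs from a touching coordinate to a non-touching one, so
      \<open>F k\<close> separates \<open>x\<close> from \<open>t *\<^sub>R y\<close>, although both
      give the same eigenvalue expression at \<open>k\<close>.\<close>
    have "x $ k' < (t *\<^sub>R y) $ k'"
      using k(2) t(2) by (auto simp: less_eq_vec_def order_less_le)
    then have "F k x < F k (t *\<^sub>R y)"
      by (intro strict[OF k(3) pos(1) t(2)])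
    also have "\<dots> = l * (x $ k) powr \<delta> k"
      using homogeneous[OF t(1) pos(2)] k t eq pos(2)[of k] by (simp add: powr_mult)
    finally show False using eq by simp
  qed
  then show ?thesis
    using t by (intro exI[of _ t]) (auto simp: vec_eq_iff)
qed

section \<open>Existence of an eigenpair by minimising the largest ratio\<close>

definition ratio :: "real ^ 'n \<Rightarrow> 'n \<Rightarrow> real" where
  "ratio x i = F i x / (x $ i) powr \<delta> i"

text \<open>\<open>infnorm\<close> makes continuity immediate; on positive vectors the absolute
  values change nothing, since \<open>F\<close> is nonnegative there.\<close>

definition max_ratio :: "real ^ 'n \<Rightarrow> real" where
  "max_ratio x = infnorm (\<chi> i. ratio x i)"

lemma max_ratio_eq:
  assumes "\<And>i. 0 < x $ i"
  shows "max_ratio x = Max (range (ratio x))"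
proof -
  have "\<bar>ratio x i\<bar> = ratio x i" for i
    using nonneg[OF assms] by (simp add: ratio_def)
  then have "{\<bar>ratio x i\<bar> |i. i \<in> UNIV} = range (ratio x)"
    by auto
  then show ?thesis
    by (simp add: max_ratio_def infnorm_cart cSup_eq_Max)
qed

lemma ratio_le_max_ratio:
  assumes "\<And>i. 0 < x $ i"
  shows "ratio x i \<le> max_ratio x"
  by (simp add: max_ratio_eq[OF assms])

lemma ratio_scaleR:
  assumes "0 < t" "\<And>i. 0 < x $ i"
  shows "ratio (t *\<^sub>R x) i = ratio x i"
  using homogeneous[OF assms] assms(1) assms(2)[of i] by (simp add: ratio_def powr_mult)

lemma max_ratio_scaleR:
  assumes "0 < t" "\<And>i. 0 < x $ i"
  shows "max_ratio (t *\<^sub>R x) = max_ratio x"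
  using ratio_scaleR[OF assms] by (simp add: max_ratio_def)

lemma continuous_on_max_ratio: "continuous_on {x. \<forall>i. 0 < x $ i} max_ratio"
  unfolding max_ratio_def ratio_def
  by (intro continuous_intros continuous) (auto, (metis less_irrefl)+)

text \<open>Boundedness propagates along edges: it starts at a coordinate equal to 1, and
  \<open>F i x \<le> M * (x $ i) powr \<delta> i\<close> passes it from \<open>i\<close> to its successors by coercivity.\<close>

lemma coordinate_bound:
  "\<exists>C. \<forall>x. (\<forall>k. 1 \<le> x $ k) \<longrightarrow> x $ i = 1 \<longrightarrow> max_ratio x \<le> M \<longrightarrow> x $ j \<le> C"
  using connected[of i j]
proof (induction rule: rtrancl_induct)
  case base
  then show ?case by (intro exI[of _ 1]) auto
next
  case (step j k)
  then obtain C where C: "\<And>x. (\<forall>k. 1 \<le> x $ k) \<Longrightarrow> x $ i = 1 \<Longrightarrow> max_ratio x \<le> M \<Longrightarrow> x $ j \<le> C"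
    by blast
  \<comment> \<open>\<open>\<bar>M\<bar>\<close> keeps the bound nondecreasing in
    \<open>x $ j\<close> even when \<open>M\<close> is negative.\<close>
  obtain D where D: "\<And>x. (\<forall>k. 1 \<le> x $ k) \<Longrightarrow> F j x \<le> \<bar>M\<bar> * C powr \<delta> j \<Longrightarrow> x $ k \<le> D"
    using coercive[OF step.hyps(2)] by blast
  have "x $ k \<le> D" if x: "\<forall>k. 1 \<le> x $ k" "x $ i = 1" "max_ratio x \<le> M" for x
  proof (rule D[OF x(1)])
    have pos: "0 < x $ k" for k
      using x(1) by (metis less_le_trans zero_less_one)
    have "ratio x j \<le> \<bar>M\<bar>"
      using ratio_le_max_ratio[OF pos, of j] x(3) by linarith
    then have "F j x \<le> \<bar>M\<bar> * (x $ j) powr \<delta> j"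
      using pos[of j] by (simp add: ratio_def pos_divide_le_eq)
    also have "\<dots> \<le> \<bar>M\<bar> * C powr \<delta> j"
      using C[OF x] pos[of j] delta_pos[of j]
      by (intro mult_left_mono powr_mono2) auto
    finally show "F j x \<le> \<bar>M\<bar> * C powr \<delta> j" .
  qed
  then show ?case by blast
qed

lemma uniform_bound:
  "\<exists>C. \<forall>i j x. (\<forall>k. 1 \<le> x $ k) \<longrightarrow> x $ i = 1 \<longrightarrow> max_ratio x \<le> M \<longrightarrow> x $ j \<le> C"
proof -
  obtain C where C: "\<And>i j x. (\<forall>k. 1 \<le> x $ k) \<Longrightarrow> x $ i = 1 \<Longrightarrow> max_ratio x \<le> M \<Longrightarrow> x $ j \<le> C i j"
    using coordinate_bound[of _ M] by metis
  have "C i j \<le> Max (range (\<lambda>(i, j). C i j))" for i j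
    by (rule Max_ge) auto
  then show ?thesis
    using C by (meson order_trans)
qed

text \<open>Scale invariance reduces the noncompact orthant to vectors with smallest coordinate 1;
  those doing no worse than \<open>one\<close> lie in a compact box.\<close>

lemma max_ratio_attains_min:
  obtains x where "\<And>i. 0 < x $ i" "\<And>y. (\<And>i. 0 < y $ i) \<Longrightarrow> max_ratio x \<le> max_ratio y"
proof -
  define one :: "real ^ 'n" where "one = (\<chi> i. 1)"
  obtain C where C: "\<And>i j x. (\<forall>k. 1 \<le> x $ k) \<Longrightarrow> x $ i = 1 \<Longrightarrow> max_ratio x \<le> max_ratio one \<Longrightarrow> x $ j \<le> C"
    using uniform_bound[of "max_ratio one"] by blast
  \<comment> \<open>The upper corner \<open>max 1 C\<close> puts \<open>one\<close> into the box
    whatever the value of \<open>C\<close>.\<close>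
  define K where "K = cbox one (\<chi> i. max 1 C)"
  have K: "x \<in> K \<longleftrightarrow> (\<forall>i. 1 \<le> x $ i \<and> x $ i \<le> max 1 C)" for x
    by (simp add: K_def one_def mem_box_cart)
  have pos: "0 < x $ i" if "x \<in> K" for x i
    using that K by (metis less_le_trans zero_less_one)
  have "one \<in> K"
    by (auto simp: K one_def)
  moreover have "continuous_on K max_ratio"
    using pos by (intro continuous_on_subset[OF continuous_on_max_ratio]) auto
  ultimately obtain x where x: "x \<in> K" "\<And>y. y \<in> K \<Longrightarrow> max_ratio x \<le> max_ratio y"
    using continuous_attains_inf[of K max_ratio] unfolding K_def by (metis compact_cbox empty_iff)
  have "max_ratio x \<le> max_ratio y" if y: "\<And>i. 0 < y $ i" for y
  proof (cases "max_ratio y \<le> max_ratio one")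
    case True
    have "Min (range (\<lambda>i. y $ i)) \<in> range (\<lambda>i. y $ i)"
      by (intro Min_in) auto
    then obtain i where "Min (range (\<lambda>i. y $ i)) = y $ i" by blast
    then have i: "y $ i \<le> y $ k" for k
      by (metis Min_le finite finite_imageI rangeI)
    define z where "z = inverse (y $ i) *\<^sub>R y"
    have z: "max_ratio z = max_ratio y"
      unfolding z_def using y by (intro max_ratio_scaleR) auto
    have z1: "1 \<le> z $ k" for k
      using i[of k] y[of i] by (simp add: z_def field_simps)
    moreover have "z $ i = 1"
      using y[of i] by (simp add: z_def)
    ultimately have "z $ k \<le> C" for k
      using C z True by auto
    then have "z \<in> K"
      using z1 by (auto simp: K le_max_iff_disj)
    then show ?thesis using x(2) z by metis
  next
    case False
    then show ?thesis using x(2)[OF \<open>one \<in> K\<close>] by linarith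
  qed
  then show thesis
    using that pos[OF x(1)] by blast
qed

text \<open>Among all minimisers of \<open>max_ratio\<close> take one with the fewest coordinates attaining the
  maximum. If some coordinate did not attain it, follow an edge from an attaining \<open>i\<close> to a
  non-attaining \<open>j\<close>: a slight decrease of \<open>x $ j\<close> keeps \<open>j\<close> non-attaining and removes \<open>i\<close>.\<close>

lemma eigenpair_exists: "\<exists>l x. eigenpair l x"
proof -
  obtain z where z: "\<And>i. 0 < z $ i" "\<And>y. (\<And>i. 0 < y $ i) \<Longrightarrow> max_ratio z \<le> max_ratio y"
    using max_ratio_attains_min by blast
  define l where "l = max_ratio z"
  \<comment> \<open>These are the positive vectors with \<open>max_ratio x \<le> l\<close>, hence
    exactly the minimisers, described without division.\<close>
  define feasible where
    "feasible x \<longleftrightarrow> (\<forall>i. 0 < x $ i) \<and> (\<forall>i. F i x \<le> l * (x $ i) powr \<delta> i)" for x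
  define active where "active x = {i. F i x = l * (x $ i) powr \<delta> i}" for x
  have "feasible z"
    unfolding feasible_def
  proof (intro conjI allI)
    show "F i z \<le> l * (z $ i) powr \<delta> i" for i
      using ratio_le_max_ratio[OF z(1), of i] z(1)[of i]
      by (simp add: ratio_def l_def pos_divide_le_eq)
  qed (rule z(1))
  then obtain x where x: "feasible x" "\<And>y. feasible y \<Longrightarrow> card (active x) \<le> card (active y)"
    using ex_has_least_nat[of feasible z "\<lambda>x. card (active x)"] by auto
  have pos: "0 < x $ i" and le: "F i x \<le> l * (x $ i) powr \<delta> i" for i
    using x(1) by (auto simp: feasible_def)
  \<comment> \<open>With no active index, all ratios would lie strictly below the minimum
    \<open>l\<close>.\<close>
  have "active x \<noteq> {}"
  proof
    assume "active x = {}"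
    then have "F i x < l * (x $ i) powr \<delta> i" for i
      using le[of i] by (auto simp: active_def order_less_le)
    then have "ratio x i < l" for i
      using pos[of i] by (simp add: ratio_def pos_divide_less_eq)
    then have "max_ratio x < l"
      by (simp add: max_ratio_eq[OF pos])
    then show False
      using z(2)[OF pos] by (simp add: l_def)
  qed
  moreover have "active x = UNIV"
  proof (rule ccontr)
    assume "active x \<noteq> UNIV"
    with \<open>active x \<noteq> {}\<close> obtain i j where i: "i \<in> active x" "j \<notin> active x" "(i, j) \<in> E"
      using edge_leaving by (metis UNIV_eq_I ex_in_conv)
    have j: "F j x < l * (x $ j) powr \<delta> j"
      using le[of j] i(2) by (auto simp: active_def order_less_le)
    have "0 < l * (x $ j) powr \<delta> j"
      using nonneg[OF pos, of j] j by linarith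
    then have l: "0 < l"
      by (simp add: zero_less_mult_iff)
    \<comment> \<open>At \<open>t\<close> the index \<open>j\<close> would become active if
      \<open>F j\<close> kept its value at \<open>x\<close>:
      \<open>l * t powr \<delta> j = F j x\<close>.\<close>
    define t where "t = (F j x / l) powr (1 / \<delta> j)"
    have t: "0 \<le> t" "t powr \<delta> j = F j x / l"
      using nonneg[OF pos, of j] l delta_pos[of j] by (auto simp: t_def powr_powr)
    have "t powr \<delta> j < (x $ j) powr \<delta> j"
      using t j l by (simp add: pos_divide_less_eq mult.commute)
    then have "t < x $ j"
      using powr_mono2[of "\<delta> j" "x $ j" t] delta_pos[of j] pos[of j] by linarith
    \<comment> \<open>The midpoint lowers \<open>x $ j\<close> while staying above \<open>t\<close>,
      so \<open>j\<close> remains inactive; it is positive even if \<open>t = 0\<close>.\<close>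
    define s where "s = (t + x $ j) / 2"
    have s: "t < s" "s < x $ j" "0 < s"
      using \<open>t < x $ j\<close> t(1) by (auto simp: s_def)
    define y where "y = (\<chi> k. if k = j then s else x $ k)"
    have y: "y $ j = s" "\<And>k. k \<noteq> j \<Longrightarrow> y $ k = x $ k"
      by (auto simp: y_def)
    have ypos: "0 < y $ k" for k
      using s pos by (auto simp: y_def)
    have yx: "y \<le> x"
      using s by (auto simp: less_eq_vec_def y_def)
    have Fy: "F k y \<le> F k x" for k
      by (rule mono[OF ypos yx])
    have "F j x / l < s powr \<delta> j"
      using powr_less_mono2[OF delta_pos[of j] t(1) s(1)] t(2) by simp
    then have jy: "F j y < l * (y $ j) powr \<delta> j"
      using Fy[of j] l y by (simp add: pos_divide_less_eq mult.commute)
    have iy: "F i y < F i x"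
      using strict[OF i(3) ypos yx] s y by simp
    have "feasible y"
      unfolding feasible_def using ypos jy Fy le y(2) by (metis less_imp_le order_trans)
    moreover have "active y \<subset> active x"
    proof -
      \<comment> \<open>Away from \<open>j\<close> the right-hand side is unchanged and
        \<open>F k\<close> can only drop, so no index becomes active.\<close>
      have "k \<in> active x" if "k \<in> active y" for k
        using that jy Fy[of k] le[of k] y(2)[of k] by (cases "k = j") (auto simp: active_def)
      moreover have "i \<notin> active y"
        using iy i jy y(2)[of i] by (cases "i = j") (auto simp: active_def)
      ultimately show ?thesis using i(1) by blast
    qed
    then have "card (active y) < card (active x)"
      by (intro psubset_card_mono) auto
    ultimately show False
      using x(2) by (metis leD)
  qed
  ultimately show ?thesis
    using pos by (auto simp: eigenpair_def active_def)
qed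

end

section \<open>Homogenization of polynomials\<close>

lemma monom_degree_le_poly_degree:
  assumes "m \<in> Poly_Mapping.keys q"
  shows "monom_degree m \<le> poly_degree q"
  unfolding poly_degree_def using assms by (intro Max_ge) auto

lemma poly_eval_nonneg:
  assumes "\<And>m. 0 \<le> Poly_Mapping.lookup q m" "\<And>i. 0 \<le> x $ i"
  shows "0 \<le> poly_eval q x"
  unfolding poly_eval_def using assms by (intro sum_nonneg mult_nonneg_nonneg prod_nonneg) auto

text \<open>Nonnegative terms cannot cancel, so the value is positive exactly when some monomial is.
  The sign thus depends only on the support of \<open>x\<close>.\<close>

lemma poly_eval_pos_iff:
  assumes "\<And>m. 0 \<le> Poly_Mapping.lookup q m" "\<And>i. 0 \<le> x $ i"
  shows "0 < poly_eval q x \<longleftrightarrow>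
    (\<exists>m\<in>Poly_Mapping.keys q. \<forall>i. 0 < Poly_Mapping.lookup m i \<longrightarrow> 0 < x $ i)"
proof -
  have c: "Poly_Mapping.lookup q m \<noteq> 0" if "m \<in> Poly_Mapping.keys q" for m
    using that by (simp add: in_keys_iff)
  have "poly_eval q x = 0 \<longleftrightarrow>
      (\<forall>m\<in>Poly_Mapping.keys q. \<exists>i. 0 < Poly_Mapping.lookup m i \<and> x $ i = 0)"
    unfolding poly_eval_def using assms c
    by (subst sum_nonneg_eq_0_iff) (auto intro!: mult_nonneg_nonneg prod_nonneg)
  then show ?thesis
    using poly_eval_nonneg[OF assms] assms(2) by (metis order_less_le)
qed

section \<open>The p-norm on positive vectors, for every p > 0\<close>

lemma lp_norm_pos:
  assumes "\<And>i. 0 < x $ i"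
  shows "0 < lp_norm p x"
proof -
  have "0 < (\<Sum>i\<in>UNIV. \<bar>x $ i\<bar> powr p)"
    using assms by (intro sum_pos) (auto, (metis less_irrefl)+)
  then show ?thesis
    unfolding lp_norm_def by simp
qed

lemma lp_norm_scaleR:
  assumes "0 < t" "0 < p"
  shows "lp_norm p (t *\<^sub>R x) = t * lp_norm p x"
  using assms
  by (simp add: lp_norm_def abs_mult powr_mult powr_powr sum_nonneg flip: sum_distrib_left)

lemma lp_norm_mono:
  assumes "0 < p" "\<And>i. 0 < x $ i" "x \<le> y"
  shows "lp_norm p x \<le> lp_norm p y"
proof -
  have "\<bar>x $ i\<bar> \<le> \<bar>y $ i\<bar>" for i
    using assms(2)[of i] assms(3) by (auto simp: less_eq_vec_def intro: order_trans)
  then show ?thesis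
    unfolding lp_norm_def using assms(1) by (intro powr_mono2 sum_mono sum_nonneg) auto
qed

lemma lp_norm_strict_mono:
  assumes "0 < p" "\<And>i. 0 < x $ i" "x \<le> y" "x $ j < y $ j"
  shows "lp_norm p x < lp_norm p y"
proof -
  have "\<bar>x $ i\<bar> \<le> \<bar>y $ i\<bar>" for i
    using assms(2)[of i] assms(3) by (auto simp: less_eq_vec_def intro: order_trans)
  moreover have "\<bar>x $ j\<bar> < \<bar>y $ j\<bar>"
    using assms(2)[of j] assms(4) by auto
  ultimately have "(\<Sum>i\<in>UNIV. \<bar>x $ i\<bar> powr p) < (\<Sum>i\<in>UNIV. \<bar>y $ i\<bar> powr p)"
    using assms(1)
    by (intro sum_strict_mono_ex1) (auto intro!: powr_mono2 powr_less_mono2 exI[of _ j])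
  then show ?thesis
    unfolding lp_norm_def using assms(1) by (intro powr_less_mono2) (auto intro: sum_nonneg)
qed

lemma component_le_lp_norm:
  assumes "0 < p" "0 \<le> x $ i"
  shows "x $ i \<le> lp_norm p x"
proof -
  have "(x $ i) powr p \<le> (\<Sum>i\<in>UNIV. \<bar>x $ i\<bar> powr p)"
    using member_le_sum[of i UNIV "\<lambda>i. \<bar>x $ i\<bar> powr p"] assms(2) by auto
  then have "((x $ i) powr p) powr (1 / p) \<le> lp_norm p x"
    unfolding lp_norm_def using assms by (intro powr_mono2) auto
  then show ?thesis
    using assms by (simp add: powr_powr)
qed

lemma continuous_on_lp_norm: "continuous_on {x. \<forall>i. 0 < x $ i} (lp_norm p)"
proof -
  have "(\<Sum>i\<in>UNIV. \<bar>x $ i\<bar> powr p) \<noteq> 0" if "\<forall>i. 0 < x $ i" for x :: "real ^ 'a"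
    using lp_norm_pos[of x p] that by (auto simp: lp_norm_def)
  then show ?thesis
    unfolding lp_norm_def by (intro continuous_intros) (auto, (metis less_irrefl)+)
qed

section \<open>Monomials on positive vectors\<close>

definition monom_eval :: "('n::finite \<Rightarrow>\<^sub>0 nat) \<Rightarrow> real ^ 'n \<Rightarrow> real" where
  "monom_eval m x = (\<Prod>i\<in>UNIV. (x $ i) ^ Poly_Mapping.lookup m i)"

lemma monom_eval_pos: "(\<And>i. 0 < x $ i) \<Longrightarrow> 0 < monom_eval m x"
  by (simp add: monom_eval_def prod_pos)

lemma monom_eval_scaleR: "monom_eval m (t *\<^sub>R x) = t ^ monom_degree m * monom_eval m x"
  by (simp add: monom_eval_def monom_degree_def power_mult_distrib prod.distrib power_sum)

lemma monom_eval_mono: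
  assumes "\<And>i. 0 < x $ i" "x \<le> y"
  shows "monom_eval m x \<le> monom_eval m y"
  unfolding monom_eval_def using assms
  by (intro prod_mono conjI power_mono zero_le_power) (auto simp: less_eq_vec_def less_imp_le)

lemma monom_eval_split:
  "monom_eval m x = (x $ j) ^ Poly_Mapping.lookup m j *
     (\<Prod>i\<in>UNIV - {j}. (x $ i) ^ Poly_Mapping.lookup m i)"
  unfolding monom_eval_def by (rule prod.remove) auto

lemma monom_eval_strict_mono:
  assumes "\<And>i. 0 < x $ i" "x \<le> y" "x $ j < y $ j" "0 < Poly_Mapping.lookup m j"
  shows "monom_eval m x < monom_eval m y"
proof -
  have "(\<Prod>i\<in>UNIV - {j}. (x $ i) ^ Poly_Mapping.lookup m i)
      \<le> (\<Prod>i\<in>UNIV - {j}. (y $ i) ^ Poly_Mapping.lookup m i)"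
    using assms(1,2)
    by (intro prod_mono conjI power_mono zero_le_power) (auto simp: less_eq_vec_def less_imp_le)
  moreover have "(x $ j) ^ Poly_Mapping.lookup m j < (y $ j) ^ Poly_Mapping.lookup m j"
    using assms(1)[of j] assms(3,4) by (intro power_strict_mono) auto
  moreover have "0 < (\<Prod>i\<in>UNIV - {j}. (x $ i) ^ Poly_Mapping.lookup m i)"
    using assms(1) by (intro prod_pos) auto
  ultimately show ?thesis
    unfolding monom_eval_split[of m _ j] using assms(1)[of j]
    by (intro mult_less_le_imp_less) auto
qed

text \<open>All factors are at least 1, and the power of \<open>x $ j\<close> has exponent at least
  1. This serves coercivity along edges given by an occurring variable.\<close>

lemma component_le_monom_eval:
  assumes "\<And>i. 1 \<le> x $ i" "0 < Poly_Mapping.lookup m j"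
  shows "x $ j \<le> monom_eval m x"
proof -
  have "x $ j \<le> (x $ j) ^ Poly_Mapping.lookup m j"
    using assms by (intro self_le_power) auto
  moreover have "1 \<le> (\<Prod>i\<in>UNIV - {j}. (x $ i) ^ Poly_Mapping.lookup m i)"
    using assms by (intro prod_ge_1) (auto intro: one_le_power)
  ultimately show ?thesis
    unfolding monom_eval_split[of m _ j] using assms(1)[of j]
    by (smt (verit) mult_left_mono mult_cancel_left1 mult.right_neutral)
qed

lemma one_le_monom_eval:
  assumes "\<And>i. 1 \<le> x $ i"
  shows "1 \<le> monom_eval m x"
  unfolding monom_eval_def using assms by (intro prod_ge_1) (auto intro: one_le_power)

lemma continuous_on_monom_eval: "continuous_on S (monom_eval m)"
  unfolding monom_eval_def by (intro continuous_intros)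

text \<open>The monomials of degree less than \<open>e\<close> are multiplied by powers of the norm, so that the
  result is homogeneous of degree \<open>e\<close> and agrees with the polynomial on the sphere of radius \<open>a\<close>.\<close>

definition homogenization_term ::
    "real \<Rightarrow> real \<Rightarrow> real \<Rightarrow> ('n::finite \<Rightarrow>\<^sub>0 nat) \<Rightarrow> real ^ 'n \<Rightarrow> real" where
  "homogenization_term a p e m x =
     monom_eval m x * (lp_norm p x / a) powr (e - real (monom_degree m))"

definition homogenization :: "real \<Rightarrow> real \<Rightarrow> real \<Rightarrow> 'n::finite rpoly \<Rightarrow> real ^ 'n \<Rightarrow> real" where
  "homogenization a p e q x =
     (\<Sum>m\<in>Poly_Mapping.keys q. Poly_Mapping.lookup q m * homogenization_term a p e m x)"

lemma homogenization_on_sphere: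
  assumes "0 < a" "lp_norm p x = a"
  shows "homogenization a p e q x = poly_eval q x"
  using assms
  by (simp add: homogenization_def homogenization_term_def poly_eval_def monom_eval_def)

section \<open>Homogeneity, monotonicity and coercivity of the homogenized monomials\<close>

context
  fixes a p e :: real
  assumes a: "0 < a" and p: "0 < p"
begin

lemma homogenization_term_pos:
  assumes "\<And>i. 0 < x $ i"
  shows "0 < homogenization_term a p e m x"
  using monom_eval_pos[OF assms] lp_norm_pos[OF assms, of p] a by (simp add: homogenization_term_def)

lemma homogenization_term_scaleR:
  assumes "0 < t" "\<And>i. 0 < x $ i"
  shows "homogenization_term a p e m (t *\<^sub>R x) = t powr e * homogenization_term a p e m x"
proof -
  have "(t * lp_norm p x / a) powr (e - real (monom_degree m))
      = t powr (e - real (monom_degree m)) * (lp_norm p x / a) powr (e - real (monom_degree m))"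
    using assms(1) lp_norm_pos[OF assms(2), of p] a by (simp add: powr_mult flip: times_divide_eq_right)
  moreover have "t powr e = t ^ monom_degree m * t powr (e - real (monom_degree m))"
    using assms(1) by (simp add: powr_diff powr_realpow)
  ultimately show ?thesis
    using assms p
    by (simp add: homogenization_term_def monom_eval_scaleR lp_norm_scaleR)
qed

lemma homogenization_term_mono:
  assumes "\<And>i. 0 < x $ i" "x \<le> y" "real (monom_degree m) \<le> e"
  shows "homogenization_term a p e m x \<le> homogenization_term a p e m y"
  unfolding homogenization_term_def
  using monom_eval_pos[OF assms(1), of m] monom_eval_mono[OF assms(1,2), of m]
    lp_norm_pos[OF assms(1), of p] lp_norm_mono[OF p assms(1,2)] a assms(3)
  by (intro mult_mono powr_mono2 divide_right_mono) auto

text \<open>The two alternatives are the two sources of edges. Either the monomial itself grows with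
  \<open>x $ j\<close>, or the norm factor has a positive exponent and grows with every coordinate;
  hence a monomial of low degree yields edges to all vertices.\<close>

lemma homogenization_term_strict_mono:
  assumes "\<And>i. 0 < x $ i" "x \<le> y" "x $ j < y $ j" "real (monom_degree m) \<le> e"
    and "0 < Poly_Mapping.lookup m j \<or> real (monom_degree m) < e"
  shows "homogenization_term a p e m x < homogenization_term a p e m y"
proof -
  have N: "0 < lp_norm p x / a" "lp_norm p x / a < lp_norm p y / a"
    using lp_norm_pos[OF assms(1), of p] lp_norm_strict_mono[OF p assms(1-3)] a
    by (auto simp: divide_strict_right_mono)
  have M: "0 < monom_eval m x" "monom_eval m x \<le> monom_eval m y"
    using monom_eval_pos[OF assms(1)] monom_eval_mono[OF assms(1,2)] by auto
  from assms(5) show ?thesis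
  proof
    assume "0 < Poly_Mapping.lookup m j"
    then have "monom_eval m x < monom_eval m y"
      using monom_eval_strict_mono[OF assms(1-3)] by blast
    then show ?thesis
      unfolding homogenization_term_def using N M assms(4)
      by (intro mult_less_le_imp_less powr_mono2) auto
  next
    assume "real (monom_degree m) < e"
    then show ?thesis
      unfolding homogenization_term_def using N M
      by (intro mult_le_less_imp_less powr_less_mono2) auto
  qed
qed

lemma continuous_on_homogenization_term:
  "continuous_on {x. \<forall>i. 0 < x $ i} (homogenization_term a p e m)"
proof -
  have "lp_norm p x \<noteq> 0" if "\<forall>i. 0 < x $ i" for x :: "real ^ 'a"
    using lp_norm_pos[of x p] that by auto
  then show ?thesis
    unfolding homogenization_term_def using a
    by (intro continuous_intros continuous_on_monom_eval continuous_on_lp_norm) auto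
qed

text \<open>The same dichotomy applies. Either the monomial is at least \<open>x $ j\<close> and the
  norm factor at least \<open>(1 / a) powr r\<close>, or the monomial is at least 1 and the norm
  factor at least \<open>(x $ j / a) powr r\<close> with \<open>r > 0\<close>.\<close>

lemma homogenization_term_coercive:
  assumes "real (monom_degree m) \<le> e"
    and "0 < Poly_Mapping.lookup m j \<or> real (monom_degree m) < e"
  obtains C where "\<And>x. (\<And>i. 1 \<le> x $ i) \<Longrightarrow> homogenization_term a p e m x \<le> B \<Longrightarrow> x $ j \<le> C"
proof -
  define r where "r = e - real (monom_degree m)"
  have r: "0 \<le> r" using assms(1) by (simp add: r_def)
  have N: "(x $ j / a) powr r \<le> (lp_norm p x / a) powr r" if "\<And>i. 1 \<le> x $ i" for x
    using component_le_lp_norm[OF p, of x j] that[of j] a r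
    by (intro powr_mono2 divide_right_mono) auto
  from assms(2) show thesis
  proof
    assume m: "0 < Poly_Mapping.lookup m j"
    show thesis
    proof (rule that)
      fix x :: "real ^ 'a"
      assume x: "\<And>i. 1 \<le> x $ i" and B: "homogenization_term a p e m x \<le> B"
      have "(1 / a) powr r \<le> (x $ j / a) powr r"
        using x[of j] a r by (intro powr_mono2 divide_right_mono) auto
      with N[OF x] have "(1 / a) powr r \<le> (lp_norm p x / a) powr r"
        by linarith
      then have "x $ j * (1 / a) powr r \<le> homogenization_term a p e m x"
        unfolding homogenization_term_def r_def[symmetric]
        using component_le_monom_eval[OF x m] x[of j]
        by (intro mult_mono) auto
      also note B
      finally show "x $ j \<le> B / (1 / a) powr r"
        using a by (simp add: pos_le_divide_eq)
    qed
  next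
    assume "real (monom_degree m) < e"
    then have r: "0 < r" by (simp add: r_def)
    show thesis
    proof (rule that)
      fix x :: "real ^ 'a"
      assume x: "\<And>i. 1 \<le> x $ i" and B: "homogenization_term a p e m x \<le> B"
      have "1 * (x $ j / a) powr r \<le> homogenization_term a p e m x"
        unfolding homogenization_term_def r_def[symmetric]
        using one_le_monom_eval[OF x, of m] N[OF x] by (intro mult_mono) auto
      then have "(x $ j / a) powr r \<le> B"
        using B by simp
      then have "((x $ j / a) powr r) powr (1 / r) \<le> B powr (1 / r)"
        using r by (intro powr_mono2) auto
      then have "x $ j / a \<le> B powr (1 / r)"
        using r a x[of j] by (simp add: powr_powr)
      then show "x $ j \<le> a * B powr (1 / r)"
        using a by (simp add: pos_divide_le_eq mult.commute)
    qed
  qed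
qed

end

lemma homogeneous_system_homogenization:
  fixes P :: "'n::finite \<Rightarrow> 'n rpoly"
  assumes coeff_nonneg: "\<And>i m. 0 \<le> Poly_Mapping.lookup (P i) m"
    and delta_pos: "\<And>i. 0 < \<delta> i"
    and delta_ge: "\<And>i. real (poly_degree (P i)) \<le> \<delta> i"
    and weak: "weakly_irreducible P"
    and a: "0 < a" and p: "0 < p"
  shows "homogeneous_system (\<lambda>i. homogenization a p (\<delta> i) (P i)) \<delta> (digraph_edges P)"
proof
  have deg: "real (monom_degree m) \<le> \<delta> i" if "m \<in> Poly_Mapping.keys (P i)" for m i
    using monom_degree_le_poly_degree[OF that] delta_ge[of i] by linarith
  \<comment> \<open>The degree condition defining an edge passes from
    \<open>poly_degree (P i)\<close> to the larger or equal exponent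
    \<open>\<delta> i\<close>.\<close>
  have edge: "\<exists>m\<in>Poly_Mapping.keys (P i).
      0 < Poly_Mapping.lookup m j \<or> real (monom_degree m) < \<delta> i"
    if "(i, j) \<in> digraph_edges P" for i j
  proof -
    have "real (monom_degree m) < \<delta> i" if "monom_degree m < poly_degree (P i)" for m
      using that delta_ge[of i] by linarith
    with that show ?thesis
      unfolding digraph_edges_def appears_in_def by blast
  qed
  have coeff_pos: "0 < Poly_Mapping.lookup (P i) m" if "m \<in> Poly_Mapping.keys (P i)" for m i
    using that coeff_nonneg[of i m] by (simp add: in_keys_iff)
  fix i j :: 'n
  show "0 < \<delta> i" by (rule delta_pos)
  show "(i, j) \<in> (digraph_edges P)\<^sup>*"
    using weak by (simp add: weakly_irreducible_def)
  show "continuous_on {x. \<forall>k. 0 < x $ k} (homogenization a p (\<delta> i) (P i))"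
    unfolding homogenization_def
    by (intro continuous_intros continuous_on_homogenization_term a p)
  show "\<exists>C. \<forall>x. (\<forall>k. 1 \<le> x $ k) \<longrightarrow> homogenization a p (\<delta> i) (P i) x \<le> B \<longrightarrow> x $ j \<le> C"
    if ij: "(i, j) \<in> digraph_edges P" for B
  proof -
    obtain m where m: "m \<in> Poly_Mapping.keys (P i)"
        "0 < Poly_Mapping.lookup m j \<or> real (monom_degree m) < \<delta> i"
      using edge[OF ij] by blast
    obtain C where C: "\<And>x. (\<And>i. 1 \<le> x $ i) \<Longrightarrow>
        homogenization_term a p (\<delta> i) m x \<le> B / Poly_Mapping.lookup (P i) m \<Longrightarrow> x $ j \<le> C"
      using homogenization_term_coercive[OF a p deg[OF m(1)] m(2)] by blast
    have "x $ j \<le> C" if x: "\<forall>k. 1 \<le> x $ k" "homogenization a p (\<delta> i) (P i) x \<le> B" for x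
    proof (rule C)
      have pos: "0 < x $ k" for k
        using x(1) by (metis less_le_trans zero_less_one)
      \<comment> \<open>All terms are nonnegative, so a bound on the sum bounds the coercive
        term.\<close>
      have "Poly_Mapping.lookup (P i) m * homogenization_term a p (\<delta> i) m x
          \<le> homogenization a p (\<delta> i) (P i) x"
        unfolding homogenization_def using m(1) homogenization_term_pos[OF a p pos] coeff_pos
        by (intro member_le_sum) (auto intro!: mult_nonneg_nonneg coeff_nonneg less_imp_le)
      with x(2) show "homogenization_term a p (\<delta> i) m x \<le> B / Poly_Mapping.lookup (P i) m"
        using coeff_pos[OF m(1)] by (simp add: pos_le_divide_eq mult.commute)
    qed (use x in auto)
    then show ?thesis by blast
  qed
  fix x y :: "real ^ 'n"
  assume pos: "\<And>k. 0 < x $ k"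
  show "0 \<le> homogenization a p (\<delta> i) (P i) x"
    unfolding homogenization_def using homogenization_term_pos[OF a p pos]
    by (intro sum_nonneg mult_nonneg_nonneg coeff_nonneg less_imp_le)
  show "homogenization a p (\<delta> i) (P i) (t *\<^sub>R x) = t powr \<delta> i * homogenization a p (\<delta> i) (P i) x"
    if "0 < t" for t
    using homogenization_term_scaleR[OF a p that pos]
    by (simp add: homogenization_def sum_distrib_left mult.left_commute)
  assume xy: "x \<le> y"
  show "homogenization a p (\<delta> i) (P i) x \<le> homogenization a p (\<delta> i) (P i) y"
    unfolding homogenization_def
    by (intro sum_mono mult_left_mono coeff_nonneg homogenization_term_mono a p pos xy deg)
  assume j: "x $ j < y $ j" and ij: "(i, j) \<in> digraph_edges P"
  obtain m where m: "m \<in> Poly_Mapping.keys (P i)"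
      "0 < Poly_Mapping.lookup m j \<or> real (monom_degree m) < \<delta> i"
    using edge[OF ij] by blast
  show "homogenization a p (\<delta> i) (P i) x < homogenization a p (\<delta> i) (P i) y"
    unfolding homogenization_def
  proof (rule sum_strict_mono_ex1)
    show "\<forall>m\<in>Poly_Mapping.keys (P i).
        Poly_Mapping.lookup (P i) m * homogenization_term a p (\<delta> i) m x
        \<le> Poly_Mapping.lookup (P i) m * homogenization_term a p (\<delta> i) m y"
      by (intro ballI mult_left_mono coeff_nonneg homogenization_term_mono a p pos xy deg)
    show "\<exists>m\<in>Poly_Mapping.keys (P i).
        Poly_Mapping.lookup (P i) m * homogenization_term a p (\<delta> i) m x
        < Poly_Mapping.lookup (P i) m * homogenization_term a p (\<delta> i) m y"
      using m homogenization_term_strict_mono[OF a p pos xy j deg[OF m(1)] m(2)] coeff_pos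
      by (auto intro!: bexI[of _ m])
  qed simp
qed

section \<open>Solutions of the system\<close>

lemma unique_positive_solution:
  fixes P :: "'n::finite \<Rightarrow> 'n rpoly"
  assumes coeff_nonneg: "\<And>i m. 0 \<le> Poly_Mapping.lookup (P i) m"
    and delta_pos: "\<And>i. 0 < \<delta> i"
    and delta_ge: "\<And>i. real (poly_degree (P i)) \<le> \<delta> i"
    and weak: "weakly_irreducible P"
    and a: "0 < a" and p: "0 < p"
  shows "\<exists>!x. (\<forall>i. 0 < x $ i) \<and> solves P \<delta> x \<and> lp_norm p x = a"
proof -
  interpret homogeneous_system "\<lambda>i. homogenization a p (\<delta> i) (P i)" \<delta> "digraph_edges P"
    by (rule homogeneous_system_homogenization) fact+
  \<comment> \<open>The identification holds on this sphere only, since the homogenization depends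
    on \<open>a\<close> and \<open>p\<close>.\<close>
  have eigen: "(\<exists>l. eigenpair l x) \<longleftrightarrow> (\<forall>i. 0 < x $ i) \<and> solves P \<delta> x" if "lp_norm p x = a" for x
    using homogenization_on_sphere[OF a that]
    by (auto simp: eigenpair_def solves_def solves_with_def poly_map_def less_imp_le)
  obtain l x where x: "eigenpair l x"
    using eigenpair_exists by blast
  have pos: "0 < x $ i" for i
    using x by (simp add: eigenpair_def)
  \<comment> \<open>Rescaling moves the eigenvector to the sphere; both sides of equation
    \<open>i\<close> scale by \<open>t powr \<delta> i\<close>, so \<open>l\<close> is kept.\<close>
  define t where "t = a / lp_norm p x"
  have t: "0 < t" "lp_norm p (t *\<^sub>R x) = a"
    using a p lp_norm_pos[OF pos, of p] by (auto simp: t_def lp_norm_scaleR)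
  have "eigenpair l (t *\<^sub>R x)"
    unfolding eigenpair_def
  proof (intro conjI allI)
    fix i
    show "0 < (t *\<^sub>R x) $ i"
      using t(1) pos by simp
    have "homogenization a p (\<delta> i) (P i) x = l * (x $ i) powr \<delta> i"
      using x by (simp add: eigenpair_def)
    then show "homogenization a p (\<delta> i) (P i) (t *\<^sub>R x) = l * ((t *\<^sub>R x) $ i) powr \<delta> i"
      using homogeneous[OF t(1) pos, of i] t(1) pos[of i] by (simp add: powr_mult)
  qed
  moreover have "y = z"
    if yz: "\<exists>l. eigenpair l y" "\<exists>l. eigenpair l z" "lp_norm p y = a" "lp_norm p z = a" for y z
  proof -
    obtain s where s: "0 < s" "y = s *\<^sub>R z"
      using eigenvector_unique yz(1,2) by blast
    then have "s * a = a"
      using yz(3,4) p by (simp add: lp_norm_scaleR)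
    then show ?thesis using s a by simp
  qed
  ultimately show ?thesis
    using eigen t(2) by (intro ex1I[of _ "t *\<^sub>R x"]) blast+
qed

section \<open>Positivity of solutions for irreducible maps\<close>

text \<open>Points of one part have the same support, hence images with the same support, so a
  single point decides invariance.\<close>

lemma orthant_part_invariant:
  fixes P :: "'n::finite \<Rightarrow> 'n rpoly"
  assumes coeff_nonneg: "\<And>i m. 0 \<le> Poly_Mapping.lookup (P i) m"
    and x: "x \<in> orthant_part I" "poly_map P x \<in> orthant_part I"
  shows "poly_map P ` orthant_part I \<subseteq> orthant_part I"
proof
  fix z assume "z \<in> poly_map P ` orthant_part I"
  then obtain y where y: "y \<in> orthant_part I" "z = poly_map P y" by blast
  have "0 < poly_eval (P i) y \<longleftrightarrow> 0 < poly_eval (P i) x" for i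
    using x(1) y(1) by (simp add: poly_eval_pos_iff[OF coeff_nonneg] orthant_part_def)
  then show "z \<in> orthant_part I"
    using x(2) y poly_eval_nonneg[OF coeff_nonneg, of y]
    by (auto simp: orthant_part_def poly_map_def)
qed

text \<open>Nonnegativity of \<open>P\<close> at a positive coordinate forces \<open>l > 0\<close>.
  Then \<open>x\<close> and its image have the same support, so the part of \<open>x\<close> is
  invariant.\<close>

lemma solves_nonzero_imp_pos:
  fixes P :: "'n::finite \<Rightarrow> 'n rpoly"
  assumes coeff_nonneg: "\<And>i m. 0 \<le> Poly_Mapping.lookup (P i) m"
    and irr: "irreducible_map P"
    and sol: "solves_nonzero P \<delta> x" and "x \<noteq> 0"
  shows "0 < x $ i"
proof -
  obtain l where l: "l \<noteq> 0" "\<And>i. poly_eval (P i) x = l * (x $ i) powr \<delta> i" "\<And>i. 0 \<le> x $ i"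
    using sol by (auto simp: solves_nonzero_def solves_with_def poly_map_def)
  obtain j where "x $ j \<noteq> 0"
    using \<open>x \<noteq> 0\<close> by (auto simp: vec_eq_iff)
  then have j: "0 < x $ j"
    using l(3)[of j] by simp
  have "0 \<le> l * (x $ j) powr \<delta> j"
    using l(2) poly_eval_nonneg[OF coeff_nonneg l(3)] by metis
  then have lpos: "0 < l"
    using j l(1) by (simp add: zero_le_mult_iff)
  define I where "I = {i. 0 < x $ i}"
  have "x \<in> orthant_part I" "poly_map P x \<in> orthant_part I"
    using l lpos by (auto simp: orthant_part_def poly_map_def I_def zero_less_mult_iff order_less_le)
  then have "I = {} \<or> I = UNIV"
    using irr orthant_part_invariant[of P x I] coeff_nonneg unfolding irreducible_map_def by blast
  then show ?thesis
    using j by (auto simp: I_def)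
qed

text \<open>Irreducibility permits solutions with \<lambda> = 0 on the boundary: the map (x1 x2, x1
  x2) is irreducible and weakly irreducible but vanishes at (1, 0). The second claim is therefore
  stated for \<lambda> \<noteq> 0, and for arbitrary \<lambda> when the map has no nonzero
  nonnegative zero.\<close>

theorem theorem4p1:
  fixes P :: "'n::finite \<Rightarrow> 'n rpoly"
    and d :: "'n \<Rightarrow> nat"
    and \<delta> :: "'n \<Rightarrow> real"
  assumes degree: "\<And>i. poly_degree (P i) = d i"
    and degree_pos: "\<And>i. 1 \<le> d i"
    and coeff_nonneg: "\<And>i m. 0 \<le> Poly_Mapping.lookup (P i) m"
    and delta_pos: "\<And>i. 0 < \<delta> i"
    and delta_ge: "\<And>i. real (d i) \<le> \<delta> i"
    and weak: "weakly_irreducible P"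
  shows "(\<forall>a>0. \<forall>p>0. \<exists>!x. (\<forall>i. 0 < x $ i) \<and> solves P \<delta> x \<and> lp_norm p x = a) \<and>
    (irreducible_map P \<longrightarrow>
      (\<forall>a>0. \<forall>p>0.
         (\<exists>!x. solves_nonzero P \<delta> x \<and> lp_norm p x = a) \<and>
         (\<forall>x. solves_nonzero P \<delta> x \<and> lp_norm p x = a \<longrightarrow> (\<forall>i. 0 < x $ i))) \<and>
      ((\<forall>x. (\<forall>i. 0 \<le> x $ i) \<and> x \<noteq> 0 \<longrightarrow> poly_map P x \<noteq> 0) \<longrightarrow>
        (\<forall>a>0. \<forall>p>0.
           (\<exists>!x. solves P \<delta> x \<and> lp_norm p x = a) \<and>
           (\<forall>x. solves P \<delta> x \<and> lp_norm p x = a \<longrightarrow> (\<forall>i. 0 < x $ i)))))"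
proof (intro conjI impI allI)
  show *: "\<exists>!x. (\<forall>i. 0 < x $ i) \<and> solves P \<delta> x \<and> lp_norm p x = a" if "0 < a" "0 < p" for a p
    using delta_ge degree that
    by (intro unique_positive_solution coeff_nonneg delta_pos weak) auto
  \<comment> \<open>Degree at least 1 excludes the zero polynomial, so \<open>P i\<close> is
    positive at positive vectors and the scalar cannot be 0.\<close>
  have nonzero: "solves_nonzero P \<delta> x" if x: "\<forall>i. 0 < x $ i" "solves P \<delta> x" for x
  proof -
    obtain l where l: "solves_with P \<delta> l x"
      using x(2) by (auto simp: solves_def)
    obtain i :: 'n where True by blast
    have "Poly_Mapping.keys (P i) \<noteq> {}"
      using degree[of i] degree_pos[of i] by (auto simp: poly_degree_def)
    then have "\<exists>m\<in>Poly_Mapping.keys (P i). \<forall>j. 0 < Poly_Mapping.lookup m j \<longrightarrow> 0 < x $ j"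
      using x(1) by blast
    then have "0 < poly_eval (P i) x"
      using x(1) by (simp add: poly_eval_pos_iff[OF coeff_nonneg] less_imp_le)
    then have "l \<noteq> 0"
      using l by (auto simp: solves_with_def poly_map_def)
    then show ?thesis
      using l by (auto simp: solves_nonzero_def)
  qed
  have solves: "solves P \<delta> x" if "solves_nonzero P \<delta> x" for x
    using that by (auto simp: solves_def solves_nonzero_def)
  have norm: "x \<noteq> 0" if "lp_norm p x = a" "0 < a" for x :: "real ^ 'n" and a p
    using that by (auto simp: lp_norm_def)
  assume irr: "irreducible_map P"
  show pos: "0 < x $ i" if "0 < a" "0 < p" "solves_nonzero P \<delta> x \<and> lp_norm p x = a" for a p x i
    using solves_nonzero_imp_pos[OF coeff_nonneg irr] norm that by blast
  \<comment> \<open>Existence comes from the positive solution, whose scalar is nonzero; uniqueness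
    holds because every competitor is positive.\<close>
  show **: "\<exists>!x. solves_nonzero P \<delta> x \<and> lp_norm p x = a" if "0 < a" "0 < p" for a p
    using *[OF that] pos[OF that] nonzero solves by metis
  assume nz: "\<forall>x. (\<forall>i. 0 \<le> x $ i) \<and> x \<noteq> 0 \<longrightarrow> poly_map P x \<noteq> 0"
  \<comment> \<open>With scalar 0 the map would vanish at the nonzero vector \<open>x\<close>,
    against \<open>nz\<close>.\<close>
  have eq: "solves_nonzero P \<delta> x \<longleftrightarrow> solves P \<delta> x" if "x \<noteq> 0" for x
  proof
    assume "solves P \<delta> x"
    then obtain l where l: "solves_with P \<delta> l x"
      by (auto simp: solves_def)
    then have "poly_map P x \<noteq> 0"
      using nz that by (auto simp: solves_with_def)
    then have "l \<noteq> 0"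
      using l by (auto simp: solves_with_def vec_eq_iff)
    then show "solves_nonzero P \<delta> x"
      using l by (auto simp: solves_nonzero_def)
  qed (rule solves)
  show "\<exists>!x. solves P \<delta> x \<and> lp_norm p x = a" if "0 < a" "0 < p" for a p
    using **[OF that] eq norm that by metis
  show "0 < x $ i" if "0 < a" "0 < p" "solves P \<delta> x \<and> lp_norm p x = a" for a p x i
    using pos[of a p x i] eq norm that by blast
qed

end
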